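(* Let $k\geq1$ and $n\geq1$. The number of $k$-box paths of size $n$ equals the number of $(k+1)$-tuples of $(k+2)$-ary trees with a total of $n-1$ nodes, which is \[f_{k,n}=\frac{1}{(k+2)n-1}\binom{(k+2)n-1}{n};\] moreover, for $n\geq2$ this also equals $\frac{k+1}{n-1}\binom{(k+2)n-2}{n-2}$.
   Context: A skew Dyck path is a word $w$ over $\{U,D,L\}$ such that: $w$ contains neither $UL$ nor $LU$ as a contiguous subword; the number of $U$s equals the total number of $D$s and $L$s; and in every prefix the total number of $D$s and $L$s is at most the number of $U$s. Its semilength is its number of $U$s. A factor is a contiguous subword; $X^{m}$ denotes $m$ consecutive copies of $X$. For $k\geq1$, a $k$-box path of size $n$ is a skew Dyck path of semilength $(k+2)n-1$ containing exactly $n$ occurrences of the factor $UD^{k}L$. An $m$-ary tree is a rooted tree (possibly empty) in which each node has at most $m$ children, each child being assigned a distinct position among $m$ ordered positions (first, second, ..., $m$-th child). *)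

theory Defs
  imports Complex_Main "HOL-Library.Sublist"
begin

datatype step = U | D | L

definition skew_dyck :: "step list \<Rightarrow> bool" where
  "skew_dyck w \<longleftrightarrow>
     \<not> sublist [U, L] w \<and> \<not> sublist [L, U] w \<and>
     count_list w U = count_list w D + count_list w L \<and>
     (\<forall>p. prefix p w \<longrightarrow> count_list p D + count_list p L \<le> count_list p U)"

definition semilength :: "step list \<Rightarrow> nat" where
  "semilength w = count_list w U"

(* An occurrence of the factor v in w is identified with the part p of w preceding it;
   overlapping occurrences are counted separately. *)
definition occurrences :: "'a list \<Rightarrow> 'a list \<Rightarrow> nat" where
  "occurrences v w = card {p. prefix (p @ v) w}"

definition box_path :: "nat \<Rightarrow> nat \<Rightarrow> step list \<Rightarrow> bool" where
  "box_path k n w \<longleftrightarrow>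
     skew_dyck w \<and> semilength w = (k + 2) * n - 1 \<and>
     occurrences (U # replicate k D @ [L]) w = n"

(* A possibly empty m-ary tree: every node carries a list of exactly m subtrees, one for each
   position, and an Empty entry means that there is no child at that position. *)
datatype mtree = Empty | Node "mtree list"

fun mary :: "nat \<Rightarrow> mtree \<Rightarrow> bool" where
  "mary m Empty \<longleftrightarrow> True"
| "mary m (Node ts) \<longleftrightarrow> length ts = m \<and> (\<forall>t\<in>set ts. mary m t)"

fun nodes :: "mtree \<Rightarrow> nat" where
  "nodes Empty = 0"
| "nodes (Node ts) = Suc (\<Sum>t\<leftarrow>ts. nodes t)"

definition tree_tuples :: "nat \<Rightarrow> nat \<Rightarrow> nat \<Rightarrow> mtree list set" where
  "tree_tuples r m N =
     {ts. length ts = r \<and> (\<forall>t\<in>set ts. mary m t) \<and> (\<Sum>t\<leftarrow>ts. nodes t) = N}"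

end

theory Submission
  imports Defs
begin

text \<open>Every box except the last is followed by a further \<open>D\<close>, since \<open>LU\<close> is forbidden; counting
  down steps then leaves no room for anything else, so that a \<open>k\<close>-box path of size \<open>n\<close> is a word in
  the blocks \<open>U\<close> and \<open>U D\<^sup>k L D\<close>, of height \<open>k\<close> and with \<open>n - 1\<close> long blocks, followed by
  \<open>U D\<^sup>k L\<close>. Read from right to left, such a word is the preorder traversal of a forest: at height
  \<open>h\<close> there are \<open>h + 1\<close> trees still to be read, \<open>U\<close> says that the next one is empty, and a long block
  that it is a node, to be replaced by its \<open>k + 2\<close> subtrees. Both families thus satisfy the same
  recurrence, which the closed form solves.\<close>

section \<open>Occurrences and short factors\<close>

lemma finite_prefix_factor: "finite {p. prefix (p @ v) w}"
proof (rule finite_subset)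
  show "{p. prefix (p @ v) w} \<subseteq> set (prefixes w)"
    by (auto simp: prefix_def)
qed simp

lemma occurrences_Nil: "v \<noteq> [] \<Longrightarrow> occurrences v [] = 0"
  by (simp add: occurrences_def)

text \<open>A new last letter can complete only the occurrence that ends at it, so counting reduces
  to a suffix test at each appended letter.\<close>

lemma occurrences_snoc:
  assumes "v \<noteq> []"
  shows "occurrences v (w @ [x]) = occurrences v w + (if suffix v (w @ [x]) then 1 else 0)"
proof -
  have eq: "{p. prefix (p @ v) (w @ [x])} = {p. p @ v = w @ [x]} \<union> {p. prefix (p @ v) w}"
    by auto
  have "{p. p @ v = w @ [x]} \<inter> {p. prefix (p @ v) w} = {}"
    by (auto dest: prefix_length_le)
  moreover have "finite {p. p @ v = w @ [x]}"
    by (rule finite_subset[OF _ finite_prefix_factor[of v "w @ [x]"]]) auto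
  ultimately have "occurrences v (w @ [x]) = card {p. p @ v = w @ [x]} + occurrences v w"
    unfolding occurrences_def eq by (intro card_Un_disjoint finite_prefix_factor)
  moreover have "card {p. p @ v = w @ [x]} = (if suffix v (w @ [x]) then 1 else 0)"
  proof (cases "suffix v (w @ [x])")
    case True
    then obtain p where "w @ [x] = p @ v" by (auto simp: suffix_def)
    then have "{p. p @ v = w @ [x]} = {p}" by auto
    with True show ?thesis by simp
  next
    case False
    then have "{p. p @ v = w @ [x]} = {}" by (metis (mono_tags, lifting) Collect_empty_eq suffixI)
    with False show ?thesis by simp
  qed
  ultimately show ?thesis by simp
qed

lemma sublist2_snoc:
  "sublist [a, b] (w @ [x]) \<longleftrightarrow> sublist [a, b] w \<or> b = x \<and> suffix [a] w"
proof -
  have "suffix [a, b] (w @ [x]) \<longleftrightarrow> b = x \<and> suffix [a] w"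
    using snoc_suffix_snoc[of "[a]" b w x] by auto
  then show ?thesis by (auto simp: sublist_snoc)
qed

lemma suffix1_snoc: "suffix [a] (w @ [x]) \<longleftrightarrow> a = x"
  by (auto simp: suffix_def)

abbreviation box :: "nat \<Rightarrow> step list" where
  "box k \<equiv> U # replicate k D @ [L]"

lemma occurrences_box_snoc:
  "x \<noteq> L \<Longrightarrow> occurrences (box k) (w @ [x]) = occurrences (box k) w"
  by (auto simp: occurrences_snoc suffix_def)

lemma occurrences_box_replicate:
  "x \<noteq> L \<Longrightarrow> occurrences (box k) (w @ replicate j x) = occurrences (box k) w"
  by (induction j)
    (simp_all add: replicate_append_same[symmetric] occurrences_box_snoc flip: append_assoc)

text \<open>An occurrence ends in \<open>L\<close>, and the only \<open>L\<close> appended is the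
  final one; so no occurrence straddling the seam is gained besides the box itself.\<close>

lemma occurrences_append_box:
  "occurrences (box k) (w @ box k) = Suc (occurrences (box k) w)"
proof -
  have "occurrences (box k) (w @ box k) = occurrences (box k) (((w @ [U]) @ replicate k D) @ [L])"
    by simp
  also have "\<dots> = Suc (occurrences (box k) ((w @ [U]) @ replicate k D))"
    by (subst occurrences_snoc) (auto simp: suffix_def)
  also have "\<dots> = Suc (occurrences (box k) w)"
    by (simp only: occurrences_box_replicate occurrences_box_snoc step.distinct simp_thms)
  finally show ?thesis .
qed

text \<open>Cuts \<open>w\<close> at its last box. The part \<open>p\<close> has exactly one box
  fewer, which drives the inductions below.\<close>

lemma last_box_exists:
  assumes "occurrences (box k) w > 0"
  obtains p q where "w = p @ box k @ q" "occurrences (box k) w = Suc (occurrences (box k) p)"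
  using assms
proof (induction w arbitrary: thesis rule: rev_induct)
  case Nil
  then show ?case by (simp add: occurrences_Nil)
next
  case (snoc x w)
  show ?case
  proof (cases "suffix (box k) (w @ [x])")
    case True
    then obtain p where p: "w @ [x] = p @ box k" by (auto simp: suffix_def)
    with snoc.prems(1)[of p "[]"] occurrences_append_box[of k p] show ?thesis by simp
  next
    case False
    then have eq: "occurrences (box k) (w @ [x]) = occurrences (box k) w"
      by (simp add: occurrences_snoc)
    show ?thesis
    proof (rule snoc.IH)
      fix p q
      assume "w = p @ box k @ q" "occurrences (box k) w = Suc (occurrences (box k) p)"
      then show thesis using snoc.prems(1)[of p "q @ [x]"] eq by simp
    qed (use snoc.prems(2) eq in simp)
  qed
qed

section \<open>Block words\<close>

definition downs :: "step list \<Rightarrow> nat" where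
  "downs w = count_list w D + count_list w L"

definition nonneg :: "step list \<Rightarrow> bool" where
  "nonneg w \<longleftrightarrow> (\<forall>p. prefix p w \<longrightarrow> downs p \<le> count_list p U)"

lemma count_list_replicate: "count_list (replicate j x) y = (if x = y then j else 0)"
  by (induction j) auto

lemma downs_simps [simp]:
  "downs [] = 0"
  "downs (x # w) = (if x = U then 0 else 1) + downs w"
  "downs (v @ w) = downs v + downs w"
  "downs (replicate j x) = (if x = U then 0 else j)"
  by (cases x; simp add: downs_def count_list_replicate)+

lemma nonneg_Nil: "nonneg []"
  by (simp add: nonneg_def)

lemma nonneg_snoc:
  "nonneg (w @ [x]) \<longleftrightarrow> nonneg w \<and> downs (w @ [x]) \<le> count_list (w @ [x]) U"
  by (auto simp: nonneg_def)

lemma nonneg_appendD: "nonneg (v @ w) \<Longrightarrow> nonneg v"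
  by (auto simp: nonneg_def)

lemma nonnegD: "nonneg w \<Longrightarrow> downs w \<le> count_list w U"
  by (auto simp: nonneg_def)

text \<open>Sufficient since the height of \<open>w\<close> already pays for every down step of
  \<open>q\<close>, wherever these stand. It is applied to tails \<open>q\<close> without
  \<open>U\<close>.\<close>

lemma nonneg_append:
  "nonneg w \<Longrightarrow> downs w + downs q \<le> count_list w U \<Longrightarrow> nonneg (w @ q)"
  by (induction q rule: rev_induct) (auto simp: nonneg_snoc nonneg_def simp flip: append_assoc)

text \<open>\<open>h\<close> is the final height and \<open>N\<close> the number of long blocks. A
  long block changes the height by 1 - (k + 2) = -(k + 1) and is lowest at its end, so having
  \<open>h\<close> a natural number already keeps the path above the axis.\<close>

inductive block_word :: "nat \<Rightarrow> nat \<Rightarrow> nat \<Rightarrow> step list \<Rightarrow> bool" for k where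
  empty: "block_word k 0 0 []"
| up: "block_word k h N p \<Longrightarrow> block_word k (Suc h) N (p @ [U])"
| long: "block_word k (h + k + 1) N p \<Longrightarrow> block_word k h (Suc N) (p @ box k @ [D])"

lemma block_word_ups: "block_word k h N p \<Longrightarrow> block_word k (h + j) N (p @ replicate j U)"
proof (induction j)
  case (Suc j)
  then show ?case using block_word.up[of k "h + j" N "p @ replicate j U"]
    by (simp add: replicate_append_same)
qed simp

text \<open>As k >= 1, a \<open>D\<close> separates the \<open>U\<close> of the box from its
  \<open>L\<close>; as \<open>w\<close> does not end in \<open>L\<close>, the \<open>U\<close> of
  the box makes no factor \<open>LU\<close>.\<close>

lemma factors_append_box:
  assumes "k \<ge> 1" "\<not> suffix [L] w" "\<not> sublist [U, L] w" "\<not> sublist [L, U] w"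
  shows "\<not> sublist [U, L] (w @ box k)" "\<not> sublist [L, U] (w @ box k)"
proof -
  have *: "\<not> sublist [U, L] ((w @ [U]) @ replicate j D) \<and> \<not> sublist [L, U] ((w @ [U]) @ replicate j D)" for j
  proof (induction j)
    case 0
    then show ?case using assms by (simp add: sublist2_snoc)
  next
    case (Suc j)
    then show ?case
      by (simp only: replicate_Suc replicate_append_same[symmetric] append_assoc[symmetric] sublist2_snoc) simp
  qed
  obtain j where k: "k = Suc j" using assms(1) by (cases k) auto
  have "w @ box k = (((w @ [U]) @ replicate j D) @ [D]) @ [L]"
    by (simp add: k replicate_append_same)
  then show "\<not> sublist [U, L] (w @ box k)" "\<not> sublist [L, U] (w @ box k)"
    by (simp_all only: sublist2_snoc suffix1_snoc *[of j] simp_thms step.distinct)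
qed

text \<open>Not ending in \<open>L\<close> is part of the invariant because every block begins with
  \<open>U\<close>.\<close>

lemma block_wordD:
  assumes "block_word k h N p" "k \<ge> 1"
  shows "\<not> suffix [L] p \<and> \<not> sublist [U, L] p \<and> \<not> sublist [L, U] p \<and> nonneg p \<and>
    downs p = (k + 2) * N \<and> count_list p U = (k + 2) * N + h \<and> occurrences (box k) p = N"
  using assms(1)
proof induction
  case empty
  then show ?case by (simp add: nonneg_Nil occurrences_Nil)
next
  case (up h N p)
  then show ?case by (simp add: sublist2_snoc suffix1_snoc nonneg_snoc occurrences_box_snoc)
next
  case (long h N p)
  then have fac: "\<not> sublist [U, L] (p @ box k)" "\<not> sublist [L, U] (p @ box k)"
    using factors_append_box[OF assms(2)] by blast+
  have "nonneg (p @ [U])" using long.IH by (simp add: nonneg_snoc)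
  then have "nonneg ((p @ [U]) @ replicate k D @ [L, D])"
    by (rule nonneg_append) (use long.IH in simp)
  moreover have "occurrences (box k) ((p @ box k) @ [D]) = Suc N"
    using long.IH occurrences_append_box[of k p] by (simp only: occurrences_box_snoc step.distinct simp_thms)
  moreover have "\<not> sublist [U, L] ((p @ box k) @ [D])" "\<not> sublist [L, U] ((p @ box k) @ [D])"
    "\<not> suffix [L] ((p @ box k) @ [D])"
    using fac by (simp_all only: sublist2_snoc suffix1_snoc step.distinct simp_thms)
  ultimately show ?case using long.IH by (simp add: count_list_replicate)
qed

section \<open>Box paths as block words\<close>

text \<open>A box has k + 1 down steps, and the letter after it cannot be \<open>U\<close>, hence is
  a further down step. The \<open>U\<close> appended in the hypothesis extends this to a box at the
  very end of \<open>w\<close>.\<close>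

lemma downs_lower_bound:
  assumes "\<not> sublist [L, U] (w @ [U])"
  shows "(k + 2) * occurrences (box k) w \<le> downs w"
  using assms
proof (induction w rule: length_induct)
  case (1 w)
  show ?case
  proof (cases "occurrences (box k) w = 0")
    case False
    then obtain p q where w: "w = p @ box k @ q"
      and occ: "occurrences (box k) w = Suc (occurrences (box k) p)"
      using last_box_exists[of k w] by blast
    \<comment> \<open>The box after \<open>p\<close> starts with \<open>U\<close>, so
      \<open>p\<close> inherits the hypothesis in the same form.\<close>
    have "sublist (p @ [U]) (w @ [U])" unfolding w by (auto simp: sublist_def)
    then have "\<not> sublist [L, U] (p @ [U])" using 1(2) sublist_order.order_trans by blast
    then have IH: "(k + 2) * occurrences (box k) p \<le> downs p" using 1(1) w by simp
    have "downs q \<ge> 1"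
    proof (cases q)
      case Nil
      then have "w @ [U] = (p @ U # replicate k D) @ [L, U] @ []" by (simp add: w)
      then show ?thesis using 1(2) by (metis sublist_appendI)
    next
      case (Cons x q')
      have "x \<noteq> U"
      proof
        assume "x = U"
        then have "w @ [U] = (p @ U # replicate k D) @ [L, U] @ (q' @ [U])" by (simp add: w Cons)
        then show False using 1(2) by (metis sublist_appendI)
      qed
      then show ?thesis by (simp add: Cons)
    qed
    then show ?thesis using IH by (simp add: occ) (simp add: w)
  qed simp
qed

lemma downs_eq_0_iff: "downs w = 0 \<longleftrightarrow> w = replicate (length w) U"
  by (induction w) auto

text \<open>This is the equality case of \<open>downs_lower_bound\<close>: with no down step to
  spare, the last box is followed by one down step and then by \<open>U\<close> only, and
  \<open>p\<close> is again an equality case.\<close>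

lemma block_wordI:
  assumes "\<not> sublist [L, U] (w @ [U])" "nonneg w" "downs w \<le> (k + 2) * occurrences (box k) w"
    "count_list w U = downs w + h"
  shows "block_word k h (occurrences (box k) w) w"
  using assms
proof (induction w arbitrary: h rule: length_induct)
  case (1 w)
  note IH = 1(1) and nolu = 1(2) and nonneg = 1(3) and le = 1(4) and height = 1(5)
  show ?case
  proof (cases "occurrences (box k) w = 0")
    case True
    then have "downs w = 0" using le by simp
    then have w: "w = replicate (length w) U" by (simp add: downs_eq_0_iff)
    then have "length w = h"
      using height \<open>downs w = 0\<close> by (metis add_0 count_list_replicate)
    then show ?thesis using block_word_ups[OF block_word.empty, of k h] w True by simp
  next
    case False
    then obtain p q where w: "w = p @ box k @ q"
      and occ: "occurrences (box k) w = Suc (occurrences (box k) p)"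
      using last_box_exists[of k w] by blast
    have "sublist (p @ [U]) (w @ [U])" unfolding w by (auto simp: sublist_def)
    then have nolup: "\<not> sublist [L, U] (p @ [U])" using nolu sublist_order.order_trans by blast
    then have lb: "(k + 2) * occurrences (box k) p \<le> downs p" by (rule downs_lower_bound)
    have le': "downs p + downs q \<le> (k + 2) * occurrences (box k) p + 1"
      using le by (simp add: occ) (simp add: w)
    have nolu': "w @ [U] \<noteq> u @ [L, U] @ v" for u v
      using nolu by (metis sublist_appendI)
    obtain x q' where q: "q = x # q'"
      using nolu'[of "p @ U # replicate k D" "[]"] by (cases q) (auto simp: w)
    have "x \<noteq> U"
      using nolu'[of "p @ U # replicate k D" "q' @ [U]"] by (auto simp: w q)
    \<comment> \<open>The down step \<open>x\<close> uses up the surplus 1 in \<open>le'\<close>, so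
      \<open>lb\<close> becomes an equality.\<close>
    then have "downs q' = 0" and lep: "downs p \<le> (k + 2) * occurrences (box k) p"
      using le' lb by (simp_all add: q)
    then obtain j where q': "q' = replicate j U" by (auto simp: downs_eq_0_iff)
    \<comment> \<open>An \<open>L\<close> here would meet a \<open>U\<close>: the first one of
      \<open>q'\<close> or, if \<open>q'\<close> is empty, the appended one.\<close>
    have "x \<noteq> L"
      using nolu'[of "p @ box k" "replicate j U"]
      by (auto simp: w q q' replicate_append_same)
    with \<open>x \<noteq> U\<close> have x: "x = D" by (cases x) auto
    have w': "w = (p @ box k @ [D]) @ replicate j U" by (simp add: w q q' x)
    have "nonneg (p @ box k @ [D])" using nonneg nonneg_appendD unfolding w' by blast
    \<comment> \<open>\<open>i\<close> is the height right after the long block, whose net descent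
      is k + 1.\<close>
    from nonnegD[OF this] obtain i where i: "count_list p U = downs p + (i + k + 1)"
      by (auto simp: count_list_replicate dest!: le_Suc_ex)
    have "nonneg p" using nonneg nonneg_appendD unfolding w by blast
    then have "block_word k (i + k + 1) (occurrences (box k) p) p"
      using IH nolup lep i w by simp
    then have "block_word k (i + j) (occurrences (box k) w) w"
      unfolding occ unfolding w' by (intro block_word_ups block_word.long)
    moreover have "h = i + j" using height i by (simp add: w' count_list_replicate)
    ultimately show ?thesis by simp
  qed
qed

text \<open>The semilength allows n(k + 2) - 1 down steps, one short of a further down step after
  each box. So the last box must end the word; its net descent k forces height k before it.\<close>

lemma box_path_iff:
  assumes "k \<ge> 1" "n \<ge> 1"
  shows "box_path k n w \<longleftrightarrow> (\<exists>p. block_word k k (n - 1) p \<and> w = p @ box k)"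
proof
  assume "\<exists>p. block_word k k (n - 1) p \<and> w = p @ box k"
  then obtain p where p: "block_word k k (n - 1) p" and w: "w = p @ box k" by blast
  note p' = block_wordD[OF p assms(1)]
  have n: "(k + 2) * n - 1 = (k + 2) * (n - 1) + (k + 1)"
    using assms(2) by (cases n) auto
  have "nonneg (p @ [U])" using p' by (simp add: nonneg_snoc)
  then have "nonneg ((p @ [U]) @ replicate k D @ [L])"
    by (rule nonneg_append) (use p' in simp)
  then have "nonneg w" by (simp add: w)
  moreover have "\<not> sublist [U, L] w" "\<not> sublist [L, U] w"
    using factors_append_box[OF assms(1), of p] p' w by simp_all
  moreover have "count_list w U = (k + 2) * n - 1" "downs w = (k + 2) * n - 1"
    unfolding n using p' by (simp_all add: w count_list_replicate)
  moreover have "occurrences (box k) w = n"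
    using occurrences_append_box[of k p] p' assms(2) by (simp add: w)
  ultimately show "box_path k n w"
    by (simp add: box_path_def skew_dyck_def semilength_def nonneg_def downs_def)
next
  assume "box_path k n w"
  then have nolu: "\<not> sublist [L, U] w" and nonneg: "nonneg w"
    and ups: "count_list w U = (k + 2) * n - 1" and dn: "downs w = (k + 2) * n - 1"
    and occn: "occurrences (box k) w = n"
    by (simp_all add: box_path_def skew_dyck_def semilength_def nonneg_def downs_def)
  obtain p q where w: "w = p @ box k @ q"
    and occ: "occurrences (box k) w = Suc (occurrences (box k) p)"
    using last_box_exists[of k w] occn assms(2) by auto
  have n: "n = Suc (occurrences (box k) p)" using occ occn by simp
  have "sublist (p @ [U]) w" unfolding w by (auto simp: sublist_def)
  then have nolup: "\<not> sublist [L, U] (p @ [U])" using nolu sublist_order.order_trans by blast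
  then have lb: "(k + 2) * occurrences (box k) p \<le> downs p" by (rule downs_lower_bound)
  \<comment> \<open>The first n - 1 boxes need all of these down steps inside \<open>p\<close>.
    Hence \<open>q\<close> has none, and a nonempty \<open>q\<close> would put a \<open>U\<close>
    right after the \<open>L\<close> of the box.\<close>
  have "downs p + downs q = (k + 2) * occurrences (box k) p"
    using dn by (simp add: n) (simp add: w)
  with lb have "downs q = 0" and dp: "downs p = (k + 2) * occurrences (box k) p" by simp_all
  then have q': "q = replicate (length q) U" by (simp add: downs_eq_0_iff)
  have "q = []"
  proof (cases "length q")
    case (Suc j)
    then have "w = (p @ U # replicate k D) @ [L, U] @ replicate j U"
      using q' by (simp add: w)
    then show ?thesis using nolu by (metis sublist_appendI)
  qed simp
  moreover have "nonneg p" using nonneg nonneg_appendD unfolding w by blast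
  moreover have "count_list p U = downs p + k"
    using ups dn \<open>q = []\<close> by (simp add: w count_list_replicate)
  ultimately show "\<exists>p. block_word k k (n - 1) p \<and> w = p @ box k"
    using block_wordI[OF nolup, of k k] dp w n by auto
qed

lemma card_box_paths:
  assumes "k \<ge> 1" "n \<ge> 1"
  shows "card {w. box_path k n w} = card {p. block_word k k (n - 1) p}"
proof -
  have "{w. box_path k n w} = (\<lambda>p. p @ box k) ` {p. block_word k k (n - 1) p}"
    using box_path_iff[OF assms] by auto
  then show ?thesis by (simp add: card_image inj_on_def)
qed

section \<open>The common recurrence\<close>

lemma tree_tuples_0: "tree_tuples 0 m N = (if N = 0 then {[]} else {})"
  by (auto simp: tree_tuples_def)

lemma tree_tuples_Suc_0: "tree_tuples (Suc r) m 0 = Cons Empty ` tree_tuples r m 0"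
proof -
  have "t = Empty" if "nodes t = 0" for t
    using that by (cases t) auto
  then show ?thesis by (force simp: tree_tuples_def length_Suc_conv)
qed

text \<open>A nonempty first tree is opened: its root is removed and its m subtrees are put in front
  of the other r trees. Cutting after m trees undoes this.\<close>

lemma tree_tuples_Suc_Suc:
  "tree_tuples (Suc r) m (Suc N) = Cons Empty ` tree_tuples r m (Suc N) \<union>
    (\<lambda>ts. Node (take m ts) # drop m ts) ` tree_tuples (r + m) m N" (is "?A = ?B \<union> ?C")
proof (intro equalityI subsetI)
  fix ts assume "ts \<in> ?A"
  then obtain t ts' where ts: "ts = t # ts'" "length ts' = r" "mary m t" "\<forall>t\<in>set ts'. mary m t"
    "nodes t + (\<Sum>t\<leftarrow>ts'. nodes t) = Suc N"
    by (auto simp: tree_tuples_def length_Suc_conv)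
  show "ts \<in> ?B \<union> ?C"
  proof (cases t)
    case Empty
    then show ?thesis using ts by (auto simp: tree_tuples_def)
  next
    case (Node us)
    then have "us @ ts' \<in> tree_tuples (r + m) m N"
      "ts = Node (take m (us @ ts')) # drop m (us @ ts')"
      using ts by (auto simp: tree_tuples_def)
    then show ?thesis by blast
  qed
next
  fix ts assume "ts \<in> ?B \<union> ?C"
  then show "ts \<in> ?A"
  proof
    assume "ts \<in> ?C"
    then obtain us where us: "us \<in> tree_tuples (r + m) m N"
      and ts: "ts = Node (take m us) # drop m us" by blast
    have "(\<Sum>t\<leftarrow>take m us @ drop m us. nodes t) = N"
      using us by (simp add: tree_tuples_def)
    then have "(\<Sum>t\<leftarrow>take m us. nodes t) + (\<Sum>t\<leftarrow>drop m us. nodes t) = N"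
      by (simp only: map_append sum_list_append)
    then show ?thesis
      using us by (auto simp: ts tree_tuples_def dest: in_set_takeD in_set_dropD)
  qed (auto simp: tree_tuples_def)
qed

lemma finite_tree_tuples: "finite (tree_tuples r m N)"
proof (induction N arbitrary: r)
  case 0
  show ?case by (induction r) (simp_all add: tree_tuples_0 tree_tuples_Suc_0)
next
  case (Suc N)
  show ?case by (induction r) (simp_all add: tree_tuples_0 tree_tuples_Suc_Suc Suc)
qed

lemma card_tree_tuples_Suc_0: "card (tree_tuples (Suc r) m 0) = card (tree_tuples r m 0)"
  by (simp add: tree_tuples_Suc_0 card_image)

lemma card_tree_tuples_Suc_Suc:
  "card (tree_tuples (Suc r) m (Suc N)) =
    card (tree_tuples r m (Suc N)) + card (tree_tuples (r + m) m N)"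
proof -
  have "inj_on (\<lambda>ts. Node (take m ts) # drop m ts) (tree_tuples (r + m) m N)"
    by (rule inj_onI) (metis append_take_drop_id list.inject mtree.inject)
  then show ?thesis unfolding tree_tuples_Suc_Suc
    by (subst card_Un_disjoint) (auto simp: finite_tree_tuples card_image)
qed

section \<open>Block words, decomposed at the last block\<close>

lemma block_words_0_0: "{p. block_word k 0 0 p} = {[]}"
  by (auto intro: block_word.intros elim: block_word.cases)

lemma block_words_Suc_0:
  "{p. block_word k (Suc h) 0 p} = (\<lambda>p. p @ [U]) ` {p. block_word k h 0 p}"
  by (auto intro: block_word.intros elim: block_word.cases)

lemma block_words_0_Suc:
  "{p. block_word k 0 (Suc N) p} = (\<lambda>p. p @ box k @ [D]) ` {p. block_word k (k + 1) N p}"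
  by (auto intro: block_word.long[of k 0, simplified] elim: block_word.cases)

lemma block_words_Suc_Suc:
  "{p. block_word k (Suc h) (Suc N) p} = (\<lambda>p. p @ [U]) ` {p. block_word k h (Suc N) p} \<union>
    (\<lambda>p. p @ box k @ [D]) ` {p. block_word k (h + k + 2) N p}"
  by (auto intro: block_word.up block_word.long[of k "Suc h", simplified] elim: block_word.cases)

text \<open>Removing a long block lowers \<open>N\<close> but raises the height, hence an outer
  induction on \<open>N\<close> for all \<open>h\<close> and an inner one on
  \<open>h\<close>.\<close>

lemma card_block_words:
  "finite {p. block_word k h N p} \<and>
    card {p. block_word k h N p} = card (tree_tuples (Suc h) (k + 2) N)"
proof (induction N arbitrary: h)
  case 0
  show ?case
    by (induction h)
      (simp_all add: block_words_0_0 block_words_Suc_0 tree_tuples_0 card_tree_tuples_Suc_0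
        card_image inj_on_def)
next
  case (Suc N)
  note IHN = Suc.IH
  show ?case
  proof (induction h)
    case 0
    \<comment> \<open>At height 0 the last block cannot be \<open>U\<close>; correspondingly, no
      0-tuple of trees has a node.\<close>
    then show ?case using IHN[of "k + 1"]
      by (simp add: block_words_0_Suc card_tree_tuples_Suc_Suc tree_tuples_0 card_image inj_on_def)
  next
    case (Suc h)
    let ?A = "(\<lambda>p. p @ [U]) ` {p. block_word k h (Suc N) p}"
    let ?B = "(\<lambda>p. p @ box k @ [D]) ` {p. block_word k (h + k + 2) N p}"
    have "?A \<inter> ?B = {}" by auto
    moreover have "finite ?A" "finite ?B"
      using Suc.IH IHN by simp_all
    ultimately have "card (?A \<union> ?B) = card ?A + card ?B" by (intro card_Un_disjoint)
    also have "\<dots> = card {p. block_word k h (Suc N) p} + card {p. block_word k (h + k + 2) N p}"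
      by (simp add: card_image inj_on_def)
    finally show ?case
      unfolding block_words_Suc_Suc card_tree_tuples_Suc_Suc[of "Suc h"]
      using Suc.IH IHN[of "h + k + 2"] \<open>finite ?A\<close> \<open>finite ?B\<close> by simp
  qed
qed

section \<open>Solving the recurrence in closed form\<close>

lemma choose_Suc_absorb: "Suc N * (M choose Suc N) + N * (M choose N) = M * (M choose N)"
proof (cases "N \<le> M")
  case True
  have "Suc N * (M choose Suc N) = (M - N) * (M choose N)"
    by (simp only: binomial_absorption binomial_absorb_comp)
  then have "Suc N * (M choose Suc N) + N * (M choose N) = (M - N + N) * (M choose N)"
    by (simp only: distrib_right)
  with True show ?thesis by simp
qed (simp add: binomial_eq_0)

text \<open>These are the Raney (Fuss-Catalan) numbers, with the denominator multiplied out so that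
  the case m N + r = 0 needs no convention.\<close>

lemma card_tree_tuples:
  assumes "m \<ge> 1"
  shows "real (m * N + r) * real (card (tree_tuples r m N)) = real r * real ((m * N + r) choose N)"
proof (induction N arbitrary: r)
  case 0
  have "card (tree_tuples r m 0) = 1"
    by (induction r) (simp_all add: tree_tuples_0 card_tree_tuples_Suc_0)
  then show ?case by simp
next
  case (Suc N)
  note IHN = Suc.IH
  show ?case
  proof (induction r)
    case 0
    then show ?case by (simp add: tree_tuples_0)
  next
    case (Suc r)
    \<comment> \<open>Both terms of the recurrence have this same upper index, since m N + (r + m) =
      m (N + 1) + r.\<close>
    define M where "M = m * Suc N + r"
    define X where "X = real (M choose N)"
    define Y where "Y = real (M choose Suc N)"
    have M: "real M = real m * (real N + 1) + real r" by (simp add: M_def algebra_simps)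
    have "M > 0" using assms by (simp add: M_def)
    then have pos: "real M > 0" by simp
    have MS: "m * Suc N + Suc r = Suc M" by (simp add: M_def)
    let ?a = "real (card (tree_tuples r m (Suc N)))"
    let ?b = "real (card (tree_tuples (r + m) m N))"
    have a: "real M * ?a = real r * Y"
      using Suc.IH by (simp add: M_def Y_def)
    have b: "real M * ?b = (real r + real m) * X"
    proof -
      have "m * N + (r + m) = M" by (simp add: M_def)
      with IHN[of "r + m"] show ?thesis by (simp add: X_def)
    qed
    have absorb: "(real N + 1) * Y = (real M - real N) * X"
    proof -
      have "real (Suc N * (M choose Suc N) + N * (M choose N)) = real (M * (M choose N))"
        by (simp only: choose_Suc_absorb)
      then show ?thesis by (simp add: X_def Y_def algebra_simps)
    qed
    have "real M * ((real N + 1) * (?a + ?b))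
        = (real N + 1) * (real M * ?a) + (real N + 1) * (real M * ?b)"
      by (simp add: algebra_simps)
    also have "\<dots> = real r * ((real N + 1) * Y) + (real N + 1) * ((real r + real m) * X)"
      unfolding a b by simp
    \<comment> \<open>r (M - N) + (N + 1)(r + m) = r M + r + m (N + 1) = (r + 1) M.\<close>
    also have "\<dots> = real M * ((real r + 1) * X)"
      unfolding absorb by (simp add: M algebra_simps)
    finally have ab: "(real N + 1) * (?a + ?b) = (real r + 1) * X"
      using pos by simp
    have "(real N + 1) * ((real M + 1) * (?a + ?b)) = (real M + 1) * ((real N + 1) * (?a + ?b))"
      by simp
    also have "\<dots> = (real r + 1) * ((real M + 1) * X)"
      unfolding ab by simp
    \<comment> \<open>By Pascal's rule X + Y is the binomial coefficient of M + 1 over N + 1 that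
      the claim needs.\<close>
    also have "(real M + 1) * X = (real N + 1) * (X + Y)"
      using absorb by (simp add: algebra_simps)
    finally have "(real N + 1) * ((real M + 1) * (?a + ?b)) = (real N + 1) * ((real r + 1) * (X + Y))"
      by (simp only: mult.left_commute)
    then have "(real M + 1) * (?a + ?b) = (real r + 1) * (X + Y)"
      by (simp only: mult_cancel_left) simp
    then show ?case
      unfolding MS card_tree_tuples_Suc_Suc by (simp add: X_def Y_def algebra_simps)
  qed
qed

theorem theorem3p5:
  fixes k n :: nat
  assumes "k \<ge> 1" and "n \<ge> 1"
  shows "card {w. box_path k n w} = card (tree_tuples (k + 1) (k + 2) (n - 1)) \<and>
    real (card {w. box_path k n w}) =
      1 / real ((k + 2) * n - 1) * real (((k + 2) * n - 1) choose n) \<and>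
    (n \<ge> 2 \<longrightarrow>
      real (card {w. box_path k n w}) =
        real (k + 1) / real (n - 1) * real (((k + 2) * n - 2) choose (n - 2)))"
proof -
  define M where "M = (k + 2) * n - 1"
  define F where "F = card (tree_tuples (k + 1) (k + 2) (n - 1))"
  have card: "card {w. box_path k n w} = F"
    using card_box_paths[OF assms] card_block_words[of k k "n - 1"] by (simp add: F_def)
  obtain N where n: "n = Suc N" using assms(2) by (cases n) auto
  have M: "M = (k + 2) * N + (k + 1)" by (simp add: M_def n)
  then have "M > 0" by simp
  then have pos: "real M > 0" by simp
  have closed: "real M * real F = real (k + 1) * real (M choose N)"
    using card_tree_tuples[of "k + 2" N "k + 1"] by (simp only: M F_def n) simp
  \<comment> \<open>Moves the lower index from n - 1 to n: here M - N = (k + 1) n, so the factor k +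
    1 is absorbed.\<close>
  have "real (k + 1) * real n * real (M choose N) = real n * real (M choose n)"
  proof -
    have "real (Suc N * (M choose Suc N) + N * (M choose N)) = real (M * (M choose N))"
      by (simp only: choose_Suc_absorb)
    then show ?thesis by (simp add: M n algebra_simps)
  qed
  then have "real (k + 1) * real (M choose N) = real (M choose n)"
    using assms(2) by simp
  then have "real F = 1 / real M * real (M choose n)"
    using closed pos by (simp add: field_simps)
  moreover have "real F = real (k + 1) / real (n - 1) * real ((M - 1) choose (n - 2))" if "n \<ge> 2"
  proof -
    obtain N' where N: "N = Suc N'" using \<open>n \<ge> 2\<close> n by (cases N) auto
    \<comment> \<open>For the second formula the lower index goes down instead, and absorption
      supplies a factor M that cancels the denominator.\<close>
    have "real N * real (M choose N) = real M * real ((M - 1) choose N')"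
      using binomial_absorption[of N' M] unfolding N by (metis of_nat_mult)
    then have "real M * (real N * real F) = real M * (real (k + 1) * real ((M - 1) choose N'))"
      using closed by (metis mult.left_commute)
    then have "real N * real F = real (k + 1) * real ((M - 1) choose N')"
      using pos by simp
    then show ?thesis by (simp add: n N field_simps)
  qed
  moreover have "M - 1 = (k + 2) * n - 2" by (simp add: M_def)
  ultimately show ?thesis by (simp only: card F_def[symmetric] M_def[symmetric]) simp
qed

end
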